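(* Let $(X,d)\in\mathbf{UT}$ have at least two points and let $C(X)$ be the center of distances of $(X,d)$. Then the equality $C(X)=\{0,\operatorname{diam} X\}$ holds if and only if $X$ is a centered sphere in $(X,d)$ and $\operatorname{diam} X$ is the radius of this sphere.
   Context: $\mathbb{R}^+=[0,+\infty)$. All metric spaces are non-empty. A metric space $(X,d)$ is ultrametric if $d(x,y)\le\max\{d(x,z),d(z,y)\}$ for all $x,y,z\in X$. The distance set is $D(X):=\{d(x,y): x,y\in X\}\subseteq\mathbb{R}^+$. The diameter is $\operatorname{diam} X:=\sup\{d(x,y):x,y\in X\}$, which may equal $+\infty$. The center of distances is $C(X):=\{t\in D(X): \forall p\in X\ \exists x\in X\ d(p,x)=t\}$. A set $S\subseteq X$ is a centered sphere in $(X,d)$ if there exist $c\in S$ (the center of $S$) and $r\in\mathbb{R}^+$ (the radius of $S$) such that $S=\{x\in X: d(x,c)=r\}\cup\{c\}$. A tree is a connected (simple, undirected, possibly infinite, non-empty) graph without cycles. A labeled tree $T=T(l)$ is a tree $T$ with a labeling $l\colon V(T)\to\mathbb{R}^+$. The labeling is non-degenerate if $\max\{l(u),l(v)\}>0$ for every edge $\{u,v\}\in E(T)$. For a non-degenerate labeling, the function $d_l$ on $V(T)\times V(T)$ given by $d_l(u,u)=0$ and $d_l(u,v)=\max_{w\in V(P_{u,v})} l(w)$ for $u\ne v$, where $P_{u,v}$ is the (unique, finite) path in $T$ joining $u$ and $v$ (including its endpoints), is an ultrametric on $V(T)$. $\mathbf{UT}$ denotes the class of all ultrametric spaces isometric (via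 a bijective distance-preserving map) to $(V(T),d_l)$ for some labeled tree $T(l)$ with non-degenerate labeling. *)

theory Defs
  imports "HOL-Analysis.Analysis"
begin

locale Ultrametric_space = Metric_space M d for M :: "'a set" and d :: "'a \<Rightarrow> 'a \<Rightarrow> real" +
  assumes nonempty: "M \<noteq> {}"
    and strong_triangle: "\<lbrakk>x \<in> M; y \<in> M; z \<in> M\<rbrakk> \<Longrightarrow> d x y \<le> max (d x z) (d z y)"

definition distance_set :: "'a set \<Rightarrow> ('a \<Rightarrow> 'a \<Rightarrow> real) \<Rightarrow> real set" where
  "distance_set X d = {d x y | x y. x \<in> X \<and> y \<in> X}"

(* The supremum is taken in the extended reals, so an unbounded space has diameter \<infinity>. *)
definition diam :: "'a set \<Rightarrow> ('a \<Rightarrow> 'a \<Rightarrow> real) \<Rightarrow> ereal" where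
  "diam X d = Sup (ereal ` distance_set X d)"

definition center_of_distances :: "'a set \<Rightarrow> ('a \<Rightarrow> 'a \<Rightarrow> real) \<Rightarrow> real set" where
  "center_of_distances X d = {t \<in> distance_set X d. \<forall>p\<in>X. \<exists>x\<in>X. d p x = t}"

definition centered_sphere :: "'a set \<Rightarrow> ('a \<Rightarrow> 'a \<Rightarrow> real) \<Rightarrow> 'a set \<Rightarrow> 'a \<Rightarrow> real \<Rightarrow> bool" where
  "centered_sphere X d S c r \<longleftrightarrow>
     S \<subseteq> X \<and> c \<in> S \<and> 0 \<le> r \<and> S = {x \<in> X. d x c = r} \<union> {c}"

definition simple_graph :: "'v set \<Rightarrow> 'v set set \<Rightarrow> bool" where
  "simple_graph V E \<longleftrightarrow> E \<subseteq> {{u, v} | u v. u \<in> V \<and> v \<in> V \<and> u \<noteq> v}"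

(* A path is represented by the list of its vertices, in order. *)
definition graph_path :: "'v set \<Rightarrow> 'v set set \<Rightarrow> 'v \<Rightarrow> 'v list \<Rightarrow> 'v \<Rightarrow> bool" where
  "graph_path V E u p v \<longleftrightarrow>
     p \<noteq> [] \<and> hd p = u \<and> last p = v \<and> set p \<subseteq> V \<and> distinct p \<and>
     successively (\<lambda>x y. {x, y} \<in> E) p"

(* The closing edge joins the last vertex of the list to the first one. *)
definition graph_cycle :: "'v set \<Rightarrow> 'v set set \<Rightarrow> 'v list \<Rightarrow> bool" where
  "graph_cycle V E p \<longleftrightarrow>
     length p \<ge> 3 \<and> set p \<subseteq> V \<and> distinct p \<and>
     successively (\<lambda>x y. {x, y} \<in> E) p \<and> {last p, hd p} \<in> E"

definition graph_connected :: "'v set \<Rightarrow> 'v set set \<Rightarrow> bool" where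
  "graph_connected V E \<longleftrightarrow> (\<forall>u\<in>V. \<forall>v\<in>V. \<exists>p. graph_path V E u p v)"

definition graph_tree :: "'v set \<Rightarrow> 'v set set \<Rightarrow> bool" where
  "graph_tree V E \<longleftrightarrow>
     V \<noteq> {} \<and> simple_graph V E \<and> graph_connected V E \<and> (\<nexists>p. graph_cycle V E p)"

definition labeled_tree :: "'v set \<Rightarrow> 'v set set \<Rightarrow> ('v \<Rightarrow> real) \<Rightarrow> bool" where
  "labeled_tree V E l \<longleftrightarrow> graph_tree V E \<and> (\<forall>v\<in>V. 0 \<le> l v)"

definition nondegenerate :: "'v set set \<Rightarrow> ('v \<Rightarrow> real) \<Rightarrow> bool" where
  "nondegenerate E l \<longleftrightarrow> (\<forall>u v. {u, v} \<in> E \<longrightarrow> max (l u) (l v) > 0)"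

(* The description THE p is justified only when (V, E) is a tree and u, v lie in V. *)
definition tree_dist :: "'v set \<Rightarrow> 'v set set \<Rightarrow> ('v \<Rightarrow> real) \<Rightarrow> 'v \<Rightarrow> 'v \<Rightarrow> real" where
  "tree_dist V E l u v =
     (if u = v then 0 else Max (l ` set (THE p. graph_path V E u p v)))"

(* The type argument is the type of the vertices of the tree. Keeping it independent of
   the type of points lets a theorem assuming UT range over trees on arbitrary vertices. *)
definition UT :: "'v itself \<Rightarrow> 'a set \<Rightarrow> ('a \<Rightarrow> 'a \<Rightarrow> real) \<Rightarrow> bool" where
  "UT (_ :: 'v itself) X d \<longleftrightarrow>
     Ultrametric_space X d \<and>
     (\<exists>(V :: 'v set) E l f.
        labeled_tree V E l \<and> nondegenerate E l \<and> bij_betw f X V \<and>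
        (\<forall>x\<in>X. \<forall>y\<in>X. tree_dist V E l (f x) (f y) = d x y))"

end

theory Submission
  imports Defs
begin

text \<open>
  If \<open>diam X\<close> is a distance of \<open>X\<close>, then it is the label of some vertex \<open>c\<close> of the tree.
  Every path starting at \<open>c\<close> passes through that label, so every other point is at distance
  exactly \<open>diam X\<close> from \<open>c\<close>. Conversely, if \<open>X\<close> is a sphere centered at \<open>c\<close> with radius
  \<open>diam X\<close>, the only distances from \<open>c\<close> are \<open>0\<close> and \<open>diam X\<close>, and every other point sees \<open>c\<close>
  at distance \<open>diam X\<close>.
\<close>

lemma graph_path_same_ends:
  assumes "graph_path V E u p u"
  shows "p = [u]"
proof (cases p)
  case (Cons a p')
  with assms show ?thesis
    by (cases "p' = []") (auto simp: graph_path_def)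
qed (use assms in \<open>simp add: graph_path_def\<close>)

text \<open>Peels off the first vertex. That \<open>u\<close> stays outside the tail
  \<open>p'\<close> is recorded because the cycle built from two tails has to pass through
  \<open>u\<close> only once.\<close>

lemma graph_path_distinct_ends:
  assumes "graph_path V E u p v" "u \<noteq> v"
  obtains p' where "p = u # p'" "p' \<noteq> []" "{u, hd p'} \<in> E" "u \<notin> set p'"
    "graph_path V E (hd p') p' v"
proof -
  obtain p' where "p = u # p'"
    using assms by (cases p) (auto simp: graph_path_def)
  moreover from this have "p' \<noteq> []"
    using assms by (auto simp: graph_path_def)
  ultimately show ?thesis
    using assms that[of p'] by (auto simp: graph_path_def successively_Cons)
qed

text \<open>Go from \<open>u\<close> along \<open>p\<close> to the first vertex of \<open>q\<close>
  that lies on \<open>p\<close>, then back along \<open>q\<close> to \<open>b\<close>, which is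
  adjacent to \<open>u\<close>.\<close>

lemma diverging_paths_cycle:
  assumes p: "graph_path V E a p v" and q: "graph_path V E b q v"
    and ab: "a \<noteq> b" and u: "u \<in> V" "u \<notin> set p" "u \<notin> set q" "{u, a} \<in> E" "{u, b} \<in> E"
  shows "\<exists>c. graph_cycle V E c"
proof -
  have "v \<in> set p" "v \<in> set q"
    using p q unfolding graph_path_def by (metis last_in_set)+
  \<comment> \<open>The first meeting vertex is taken so that \<open>q1\<close> avoids
    \<open>p\<close> entirely; this makes the vertices of \<open>?c\<close> distinct.\<close>
  then obtain q1 w q2 where q_eq: "q = q1 @ w # q2" and w: "w \<in> set p"
    and q1: "\<forall>x\<in>set q1. x \<notin> set p"
    using split_list_first_prop[of q "\<lambda>x. x \<in> set p"] by metis
  obtain p1 p2 where p_eq: "p = p1 @ w # p2"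
    using w by (meson split_list)
  let ?c = "u # p1 @ w # rev q1"
  \<comment> \<open>If both were empty, \<open>w\<close> would be the head of both paths, forcing
    \<open>a = b\<close>.\<close>
  have "p1 \<noteq> [] \<or> q1 \<noteq> []"
    using p q ab p_eq q_eq by (auto simp: graph_path_def)
  then have "length ?c \<ge> 3"
    by (cases p1; cases q1) auto
  moreover have "set ?c \<subseteq> V" "distinct ?c"
    using p q u q1 unfolding p_eq q_eq by (auto simp: graph_path_def)
  moreover have "successively (\<lambda>x y. {x, y} \<in> E) ?c"
  proof -
    have "successively (\<lambda>x y. {x, y} \<in> E) (u # p)"
      using p u by (auto simp: graph_path_def successively_Cons)
    then have "successively (\<lambda>x y. {x, y} \<in> E) ((u # p1 @ [w]) @ p2)"
      by (simp add: p_eq)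
    then have "successively (\<lambda>x y. {x, y} \<in> E) (u # p1 @ [w])"
      unfolding successively_append_iff by blast
    moreover have "successively (\<lambda>x y. {x, y} \<in> E) (q1 @ [w])"
      using q unfolding q_eq graph_path_def
      by (auto simp: successively_append_iff)
    then have "successively (\<lambda>x y. {y, x} \<in> E) (rev (w # rev q1))"
      by (simp add: insert_commute)
    then have "successively (\<lambda>x y. {x, y} \<in> E) (w # rev q1)"
      unfolding successively_rev .
    ultimately show ?thesis
      using successively_append_iff[of _ "u # p1" "w # rev q1"]
        successively_append_iff[of _ "u # p1" "[w]"] by simp
  qed
  moreover have "last ?c = b"
    using q q_eq by (cases q1) (auto simp: graph_path_def)
  ultimately have "graph_cycle V E ?c"
    using u by (simp add: graph_cycle_def insert_commute)
  then show ?thesis ..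
qed

text \<open>Induction along the first path. If the second vertices differed, the two tails, which
  avoid \<open>u\<close> and both end in \<open>v\<close>, would yield a cycle; so they agree and
  the induction hypothesis applies to the tails.\<close>

lemma acyclic_graph_path_unique:
  assumes acyclic: "\<nexists>c. graph_cycle V E c"
  shows "graph_path V E u p v \<Longrightarrow> graph_path V E u q v \<Longrightarrow> p = q"
proof (induction p arbitrary: u q)
  case Nil
  then show ?case by (simp add: graph_path_def)
next
  case (Cons a p)
  show ?case
  proof (cases "u = v")
    case True
    then show ?thesis
      using Cons.prems graph_path_same_ends by metis
  next
    case False
    obtain p' where p': "a # p = u # p'" "p' \<noteq> []" "{u, hd p'} \<in> E" "u \<notin> set p'"
      "graph_path V E (hd p') p' v"
      using graph_path_distinct_ends[OF Cons.prems(1) False] by metis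
    obtain q' where q': "q = u # q'" "q' \<noteq> []" "{u, hd q'} \<in> E" "u \<notin> set q'"
      "graph_path V E (hd q') q' v"
      using graph_path_distinct_ends[OF Cons.prems(2) False] by metis
    have "u \<in> V"
      using Cons.prems(1) by (auto simp: graph_path_def)
    then have "hd p' = hd q'"
      using diverging_paths_cycle[OF p'(5) q'(5)] p' q' acyclic by blast
    then have "p' = q'"
      using Cons.IH[of "hd q'" q'] p' q' by simp
    then show ?thesis
      using p' q' by simp
  qed
qed

text \<open>Uniqueness of paths turns the definite description in \<open>tree_dist\<close> into an
  actual path.\<close>

lemma tree_dist_path:
  assumes "graph_tree V E" "u \<in> V" "v \<in> V" "u \<noteq> v"
  obtains p where "graph_path V E u p v" "tree_dist V E l u v = Max (l ` set p)"
proof -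
  obtain p where p: "graph_path V E u p v"
    using assms unfolding graph_tree_def graph_connected_def by blast
  have "(THE p. graph_path V E u p v) = p"
    using assms(1) p acyclic_graph_path_unique unfolding graph_tree_def by (metis the_equality)
  then show ?thesis
    using that p assms(4) by (simp add: tree_dist_def)
qed

lemma label_le_tree_dist:
  assumes "graph_tree V E" "u \<in> V" "v \<in> V" "u \<noteq> v"
  shows "l v \<le> tree_dist V E l u v"
proof -
  obtain p where p: "graph_path V E u p v" "tree_dist V E l u v = Max (l ` set p)"
    using tree_dist_path[OF assms] by metis
  have "v \<in> set p"
    using p(1) by (auto simp: graph_path_def)
  then show ?thesis
    using p(2) by simp
qed

text \<open>A maximum over the finite non-empty vertex set of a path is attained.\<close>

lemma tree_dist_eq_label:
  assumes "graph_tree V E" "u \<in> V" "v \<in> V" "u \<noteq> v"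
  obtains w where "w \<in> V" "tree_dist V E l u v = l w"
proof -
  obtain p where p: "graph_path V E u p v" "tree_dist V E l u v = Max (l ` set p)"
    using tree_dist_path[OF assms] by metis
  have "Max (l ` set p) \<in> l ` set p"
    using p(1) by (intro Max_in) (auto simp: graph_path_def)
  then obtain w where "w \<in> set p" "Max (l ` set p) = l w"
    by blast
  then show ?thesis
    using that[of w] p by (auto simp: graph_path_def)
qed

text \<open>The point \<open>c\<close> corresponds to a vertex whose label is \<open>d x y\<close>.
  Any path from another vertex to it contains that label, so its maximum is at least
  \<open>d x y\<close>.\<close>

lemma UT_distance_center:
  assumes "UT TYPE('v) X d" and xy: "x \<in> X" "y \<in> X" "x \<noteq> y"
  obtains c where "c \<in> X" "\<And>z. z \<in> X \<Longrightarrow> z \<noteq> c \<Longrightarrow> d x y \<le> d z c"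
proof -
  obtain V :: "'v set" and E l f where T: "graph_tree V E" and f: "bij_betw f X V"
    and "\<forall>x\<in>X. \<forall>y\<in>X. tree_dist V E l (f x) (f y) = d x y"
    using assms(1) unfolding UT_def labeled_tree_def by blast
  then have d: "d x y = tree_dist V E l (f x) (f y)" if "x \<in> X" "y \<in> X" for x y
    using that by simp
  have fV: "f z \<in> V" if "z \<in> X" for z
    using f that by (auto simp: bij_betw_def)
  have f_eq: "f z = f z' \<longleftrightarrow> z = z'" if "z \<in> X" "z' \<in> X" for z z'
    using f that by (auto simp: bij_betw_def inj_on_eq_iff)
  obtain w where "w \<in> V" "d x y = l w"
    using tree_dist_eq_label[OF T, of "f x" "f y" l] xy fV f_eq d by metis
  moreover obtain c where "c \<in> X" "w = f c"
    using f \<open>w \<in> V\<close> by (auto simp: bij_betw_def)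
  ultimately show ?thesis
    using that label_le_tree_dist[OF T] fV f_eq d by metis
qed

lemma dist_le_diam:
  assumes "x \<in> X" "y \<in> X"
  shows "ereal (d x y) \<le> diam X d"
  unfolding diam_def by (rule Sup_upper) (use assms in \<open>auto simp: distance_set_def\<close>)

theorem theorem5:
  fixes X :: "'a set" and d :: "'a \<Rightarrow> 'a \<Rightarrow> real"
  assumes "UT TYPE('v) X d"
    and "\<exists>x\<in>X. \<exists>y\<in>X. x \<noteq> y"
  shows "ereal ` center_of_distances X d = {0, diam X d} \<longleftrightarrow>
    (\<exists>c r. centered_sphere X d X c r \<and> diam X d = ereal r)"
proof -
  interpret Ultrametric_space X d
    using assms(1) by (simp add: UT_def)
  obtain a b where ab: "a \<in> X" "b \<in> X" "a \<noteq> b"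
    using assms(2) by blast
  show ?thesis
  proof
    assume "ereal ` center_of_distances X d = {0, diam X d}"
    \<comment> \<open>Lying in the image of a set of reals, the diameter is finite and is an
      attained distance.\<close>
    then obtain r where r: "r \<in> center_of_distances X d" "diam X d = ereal r"
      by (metis imageE insertCI)
    then obtain x y where xy: "x \<in> X" "y \<in> X" "r = d x y"
      by (auto simp: center_of_distances_def distance_set_def)
    have le_r: "d u v \<le> r" if "u \<in> X" "v \<in> X" for u v
      using dist_le_diam[OF that, of d] r by simp
    \<comment> \<open>Two distinct points make \<open>r\<close> positive, which rules out
      \<open>x = y\<close>.\<close>
    have "0 < d a b"
      using ab by simp
    then have "r > 0"
      using le_r[OF ab(1,2)] by linarith
    then have "x \<noteq> y"
      using xy by auto
    then obtain c where c: "c \<in> X" "\<And>z. z \<in> X \<Longrightarrow> z \<noteq> c \<Longrightarrow> r \<le> d z c"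
      using UT_distance_center[OF assms(1)] xy by metis
    have "d z c = r" if "z \<in> X" "z \<noteq> c" for z
      using c that le_r by (intro antisym) auto
    then have "centered_sphere X d X c r"
      using c \<open>r > 0\<close> by (auto simp: centered_sphere_def)
    then show "\<exists>c r. centered_sphere X d X c r \<and> diam X d = ereal r"
      using r by blast
  next
    assume "\<exists>c r. centered_sphere X d X c r \<and> diam X d = ereal r"
    then obtain c r where c: "c \<in> X" and sphere: "X = {x \<in> X. d x c = r} \<union> {c}"
      and r: "diam X d = ereal r"
      by (auto simp: centered_sphere_def)
    have rad: "d z c = r" if "z \<in> X" "z \<noteq> c" for z
      using sphere that by blast
    obtain e where e: "e \<in> X" "e \<noteq> c"
      using ab by metis
    \<comment> \<open>For \<open>p = c\<close> the witness is \<open>e\<close>; for every other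
      \<open>p\<close> it is \<open>c\<close>.\<close>
    have r_sees: "\<exists>x\<in>X. d p x = r" if "p \<in> X" for p
      using rad c e that commute by metis
    have zero_sees: "\<exists>x\<in>X. d p x = 0" if "p \<in> X" for p
      using that by auto
    have "t \<in> {0, r}" if t: "t \<in> center_of_distances X d" for t
    proof -
      \<comment> \<open>Testing \<open>t\<close> at the center is enough, since only 0 and
        \<open>r\<close> occur as distances from \<open>c\<close>.\<close>
      have "\<exists>x\<in>X. d c x = t"
        using t c by (simp add: center_of_distances_def)
      then obtain x where "x \<in> X" "d c x = t"
        by (elim bexE)
      then show ?thesis
        using rad[of x] c by (cases "x = c") (auto simp: commute)
    qed
    moreover have "{0, r} \<subseteq> center_of_distances X d"
    proof -
      have "0 \<in> distance_set X d" "r \<in> distance_set X d"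
        using c r_sees[OF c] zero_sees[OF c] unfolding distance_set_def mem_Collect_eq by metis+
      then show ?thesis
        using r_sees zero_sees by (simp add: center_of_distances_def)
    qed
    ultimately have "center_of_distances X d = {0, r}"
      by blast
    then show "ereal ` center_of_distances X d = {0, diam X d}"
      using r by (simp add: zero_ereal_def)
  qed
qed

end
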